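(* Let $f(\lambda)=\lambda_1\cdots\lambda_n-\sum_{k=0}^{n-1}c_k\sigma_k(\lambda)$ be a general inverse $\sigma_k$ type multilinear polynomial. If the diagonal restriction $r_f(x)=x^n-\sum_{k=0}^{n-1}c_k\binom{n}{k}x^k$ of $f$ is strictly right-Noetherian, then on the curve $\{\lambda_1=\cdots=\lambda_{n-1}\}$ of the level set $\{f=0\}$ with $\lambda_1>x_1$, the positive definiteness of the $(n-1)\times(n-1)$ Hessian matrix $$\Bigl(\frac{\partial^2\lambda_n}{\partial\lambda_i\,\partial\lambda_j}\Bigr)_{i,j\in\{1,\dots,n-1\}}$$ is equivalent to the monotonicity of the log-concavity ratio of $r_f(x)$. Here, $x_1$ is the largest real root of $r_f'$.
   Context: The coefficients $c_0,\dots,c_{n-1}$ are real numbers, not necessarily non-negative, and $\sigma_k$ denotes the $k$-th elementary symmetric polynomial ($\sigma_0=1$). The diagonal restriction of $f$ is $r_f(x)=f(x,\dots,x)$. On the level set $\{f=0\}$, $\lambda_n$ is regarded as the function of $(\lambda_1,\dots,\lambda_{n-1})$ given by $$\lambda_n=\frac{\sum_{k=0}^{n-1}c_k\sigma_k(\lambda_1,\dots,\lambda_{n-1})}{\lambda_1\cdots\lambda_{n-1}-\sum_{k=1}^{n-1}c_k\sigma_{k-1}(\lambda_1,\dots,\lambda_{n-1})}.$$ A real univariate polynomial $p$ of degree $n$ is right-Noetherian if for every $k\in\{0,\dots,n-2\}$ there exists a real root of the $k$-th derivative $p^{(k)}$ which is greater than or equal to the largest real root of $p^{(k+1)}$; it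 is strictly right-Noetherian if moreover the largest real root of $p$ is strictly greater than the largest real root of $p'$. The log-concavity ratio of $r_f$ at a point $x$ with $r_f'(x)\neq 0$ (in particular, at every $x>x_1$) is $\alpha_{r_f}(x)=r_f(x)\,r_f''(x)/r_f'(x)^2$. *)

theory Defs
  imports "HOL-Analysis.Analysis" "HOL-Computational_Algebra.Polynomial"
begin

text \<open>
  Points of \<open>n\<close>-space are functions \<open>\<lambda> :: nat \<Rightarrow> real\<close> of which only the
  coordinates \<open>\<lambda> 1, \<dots>, \<lambda> n\<close> are ever inspected; likewise for the domain of
  \<open>\<lambda>\<^sub>n\<close>, where only \<open>\<lambda> 1, \<dots>, \<lambda> (n - 1)\<close> matter.
\<close>

definition esym :: "nat set \<Rightarrow> nat \<Rightarrow> (nat \<Rightarrow> real) \<Rightarrow> real" where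
  "esym I k v = (\<Sum>S | S \<subseteq> I \<and> card S = k. \<Prod>i\<in>S. v i)"

definition inv_sigma :: "nat \<Rightarrow> (nat \<Rightarrow> real) \<Rightarrow> (nat \<Rightarrow> real) \<Rightarrow> real" where
  "inv_sigma n c v = (\<Prod>i\<in>{1..n}. v i) - (\<Sum>k<n. c k * esym {1..n} k v)"

definition diag_restriction :: "nat \<Rightarrow> (nat \<Rightarrow> real) \<Rightarrow> real poly" where
  "diag_restriction n c = monom 1 n - (\<Sum>k<n. monom (c k * real (n choose k)) k)"

definition last_coord_denom :: "nat \<Rightarrow> (nat \<Rightarrow> real) \<Rightarrow> (nat \<Rightarrow> real) \<Rightarrow> real" where
  "last_coord_denom n c v =
     (\<Prod>i\<in>{1..n-1}. v i) - (\<Sum>k\<in>{1..n-1}. c k * esym {1..n-1} (k - 1) v)"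

definition last_coord :: "nat \<Rightarrow> (nat \<Rightarrow> real) \<Rightarrow> (nat \<Rightarrow> real) \<Rightarrow> real" where
  "last_coord n c v =
     (\<Sum>k\<in>{0..n-1}. c k * esym {1..n-1} k v) / last_coord_denom n c v"

definition partial :: "nat \<Rightarrow> ((nat \<Rightarrow> real) \<Rightarrow> real) \<Rightarrow> (nat \<Rightarrow> real) \<Rightarrow> real" where
  "partial i g v = deriv (\<lambda>t. g (v(i := t))) (v i)"

definition hessian :: "((nat \<Rightarrow> real) \<Rightarrow> real) \<Rightarrow> (nat \<Rightarrow> real) \<Rightarrow> nat \<Rightarrow> nat \<Rightarrow> real" where
  "hessian g v i j = partial i (partial j g) v"

definition positive_definite_on :: "nat set \<Rightarrow> (nat \<Rightarrow> nat \<Rightarrow> real) \<Rightarrow> bool" where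
  "positive_definite_on I M \<longleftrightarrow>
     (\<forall>i\<in>I. \<forall>j\<in>I. M i j = M j i) \<and>
     (\<forall>w. (\<exists>i\<in>I. w i \<noteq> 0) \<longrightarrow> 0 < (\<Sum>i\<in>I. \<Sum>j\<in>I. w i * M i j * w j))"

definition is_largest_real_root :: "real poly \<Rightarrow> real \<Rightarrow> bool" where
  "is_largest_real_root p x \<longleftrightarrow> poly p x = 0 \<and> (\<forall>y. poly p y = 0 \<longrightarrow> y \<le> x)"

definition right_noetherian :: "real poly \<Rightarrow> bool" where
  "right_noetherian p \<longleftrightarrow>
     (\<forall>k. k + 2 \<le> degree p \<longrightarrow>
        (\<exists>x y. is_largest_real_root ((pderiv ^^ Suc k) p) y \<and>
               poly ((pderiv ^^ k) p) x = 0 \<and> y \<le> x))"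

definition strictly_right_noetherian :: "real poly \<Rightarrow> bool" where
  "strictly_right_noetherian p \<longleftrightarrow>
     right_noetherian p \<and>
     (\<exists>x0 x1. is_largest_real_root p x0 \<and> is_largest_real_root (pderiv p) x1 \<and> x1 < x0)"

definition log_concavity_ratio :: "real poly \<Rightarrow> real \<Rightarrow> real" where
  "log_concavity_ratio p x =
     poly p x * poly (pderiv (pderiv p)) x / (poly (pderiv p) x)^2"

definition diagonal_curve :: "nat \<Rightarrow> (nat \<Rightarrow> real) \<Rightarrow> real \<Rightarrow> (nat \<Rightarrow> real) set" where
  "diagonal_curve n c x1 =
     {v. inv_sigma n c v = 0 \<and> (\<forall>i\<in>{1..n-1}. v i = v 1) \<and> x1 < v 1}"

lemma poly_diag_restriction:
  "poly (diag_restriction n c) x = x ^ n - (\<Sum>k<n. c k * real (n choose k) * x ^ k)"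
  by (simp add: diag_restriction_def poly_monom poly_sum)

lemma esym_const: "esym {1..n} k (\<lambda>_. x) = real (n choose k) * x ^ k"
proof -
  have "esym {1..n} k (\<lambda>_. x) = (\<Sum>S | S \<subseteq> {1..n} \<and> card S = k. x ^ k)"
    unfolding esym_def by (intro sum.cong) auto
  also have "\<dots> = real (n choose k) * x ^ k"
    using n_subsets[of "{1..n}" k] by simp
  finally show ?thesis .
qed

lemma inv_sigma_diagonal: "inv_sigma n c (\<lambda>_. x) = poly (diag_restriction n c) x"
  by (simp only: inv_sigma_def esym_const poly_diag_restriction) (simp add: mult.assoc)

lemma esym_0: "finite I \<Longrightarrow> esym I 0 v = 1"
proof -
  assume "finite I"
  then have "{S. S \<subseteq> I \<and> card S = 0} = {{}}"
    by (auto dest: finite_subset)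
  then show ?thesis by (simp add: esym_def)
qed

lemma esym_insert:
  assumes "finite I" "a \<notin> I"
  shows "esym (insert a I) (Suc k) v = esym I (Suc k) v + v a * esym I k v"
proof -
  let ?A = "{S. S \<subseteq> I \<and> card S = Suc k}" and ?B = "{S. S \<subseteq> I \<and> card S = k}"
  have fin: "finite ?A" "finite ?B" using assms by auto
  have eq: "{S. S \<subseteq> insert a I \<and> card S = Suc k} = ?A \<union> insert a ` ?B"
  proof (intro equalityI subsetI)
    fix S assume S: "S \<in> {S. S \<subseteq> insert a I \<and> card S = Suc k}"
    then have f: "finite S" using assms by (auto dest: finite_subset)
    show "S \<in> ?A \<union> insert a ` ?B"
    proof (cases "a \<in> S")
      case True
      then have "S = insert a (S - {a})" "S - {a} \<in> ?B" using S f by auto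
      then show ?thesis by blast
    next
      case False then show ?thesis using S by auto
    qed
  next
    fix S assume "S \<in> ?A \<union> insert a ` ?B"
    then show "S \<in> {S. S \<subseteq> insert a I \<and> card S = Suc k}"
      using assms by (auto simp: finite_subset card_insert_if)
  qed
  have inj: "inj_on (insert a) ?B" using assms by (auto simp: inj_on_def)
  have "esym (insert a I) (Suc k) v
      = (\<Sum>S\<in>?A. \<Prod>i\<in>S. v i) + (\<Sum>S\<in>insert a ` ?B. \<Prod>i\<in>S. v i)"
    unfolding esym_def eq using fin assms by (intro sum.union_disjoint) auto
  also have "(\<Sum>S\<in>insert a ` ?B. \<Prod>i\<in>S. v i) = (\<Sum>S\<in>?B. \<Prod>i\<in>insert a S. v i)"
    by (simp add: sum.reindex[OF inj] o_def)
  also have "\<dots> = (\<Sum>S\<in>?B. v a * (\<Prod>i\<in>S. v i))"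
  proof (rule sum.cong)
    fix S assume "S \<in> ?B"
    then have "finite S" "a \<notin> S" using assms by (auto dest: finite_subset)
    then show "(\<Prod>i\<in>insert a S. v i) = v a * (\<Prod>i\<in>S. v i)" by simp
  qed simp
  finally show ?thesis by (simp add: esym_def sum_distrib_left)
qed

lemma inv_sigma_affine_last:
  assumes "1 \<le> n"
  shows "inv_sigma n c v =
    last_coord_denom n c v * v n - (\<Sum>k\<in>{0..n-1}. c k * esym {1..n-1} k v)"
proof -
  obtain m where n: "n = Suc m" using assms by (cases n) auto
  have e: "esym {1..Suc m} (Suc k) v = esym {1..m} (Suc k) v + v (Suc m) * esym {1..m} k v" for k
    using esym_insert[of "{1..m}" "Suc m" k v] by (simp add: atLeastAtMostSuc_conv)
  have s: "sum g {..<Suc m} = g 0 + sum (\<lambda>k. g (Suc k)) {..<m}" for g :: "nat \<Rightarrow> real"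
    by (rule sum.lessThan_Suc_shift)
  have s0: "sum g {0..m} = g 0 + sum (\<lambda>k. g (Suc k)) {..<m}" for g :: "nat \<Rightarrow> real"
    using s[of g] by (simp add: atLeast0AtMost lessThan_Suc_atMost)
  have s1: "sum g {1..m} = sum (\<lambda>k. g (Suc k)) {..<m}" for g :: "nat \<Rightarrow> real"
    by (rule sum.reindex_bij_witness[of _ Suc "\<lambda>k. k - 1"]) auto
  have "inv_sigma n c v = (\<Prod>i\<in>{1..m}. v i) * v (Suc m)
      - (c 0 + (\<Sum>k<m. c (Suc k) * (esym {1..m} (Suc k) v + v (Suc m) * esym {1..m} k v)))"
    unfolding inv_sigma_def n s e by (simp add: esym_0)
  also have "\<dots> = last_coord_denom n c v * v n - (\<Sum>k\<in>{0..n-1}. c k * esym {1..n-1} k v)"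
    unfolding last_coord_denom_def n diff_Suc_1 s0 s1
    by (simp add: esym_0 algebra_simps sum.distrib sum_distrib_left sum_distrib_right)
  finally show ?thesis .
qed

lemma inv_sigma_zero_iff:
  assumes "1 \<le> n" "last_coord_denom n c v \<noteq> 0"
  shows "inv_sigma n c v = 0 \<longleftrightarrow> v n = last_coord n c v"
  using assms by (simp add: inv_sigma_affine_last last_coord_def field_simps)

end

theory Submission
  imports Defs
begin

text \<open>
  Write \<open>p\<close> for the diagonal restriction, \<open>\<alpha> = p p'' / p'\<^sup>2\<close> for its log-concavity ratio, and
  \<open>M(q) = q'\<^sup>2 q'' + q q' q''' - 2 q q''\<^sup>2\<close>, so that \<open>\<alpha>' = M(p) / p'\<^sup>3\<close>.

  By symmetry, at a point of the diagonal curve all diagonal entries of the Hessian of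
  \<open>\<lambda>\<^sub>n\<close> equal some \<open>A\<close> and all other entries equal some \<open>B\<close>. Such a matrix is positive definite as
  soon as \<open>A > B\<close> and \<open>A + (n - 2) B > 0\<close>. Now \<open>A + (n - 2) B = n \<alpha>' / (n - 1)\<close>, whereas
  \<open>A > B\<close> amounts to \<open>n p p''' < (n - 2) p' p''\<close> if \<open>n \<ge> 3\<close>. This is how the Hessian and the
  ratio are linked; the entries are computed in \<open>hessian_last_coord_diagonal\<close>, and the two
  conditions are checked in \<open>hessian_positive_definite_on_diagonal\<close>.

  For a strictly right-Noetherian \<open>p\<close> both conditions in fact hold at every point to the right of
  \<open>x\<^sub>1\<close>. Hence \<open>\<alpha>' > 0\<close> there, \<open>\<alpha>\<close> is strictly increasing, and the Hessian is positive
  definite along the whole curve: the equivalences hold because all their members are true. In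
  particular \<open>\<alpha>'\<close> has no isolated zeros, which could otherwise separate strict
  monotonicity from positive definiteness.

  The inequalities come from an induction on the degree \<open>m\<close> of \<open>q\<close>, run through the derivatives
  of \<open>p\<close>. The claims are \<open>m q q'' \<le> (m - 1) q'\<^sup>2\<close> and \<open>M(q) \<ge> 0\<close> to the right of the largest
  root \<open>a\<close> of \<open>q'\<close>. Both say that some \<open>R - q\<close> is nonnegative, with
  \<open>R = (m - 1) q'\<^sup>2 / (m q'')\<close> and \<open>R = q'\<^sup>2 q'' / (2 q''\<^sup>2 - q' q''')\<close> respectively, and in either case
  the derivative of \<open>R - q\<close> is nonnegative by the same claim for \<open>q'\<close>
  (\<open>discriminant_bound_step\<close>, \<open>ratio_deriv_numerator_step\<close>). So
  \<open>R - q\<close> is nondecreasing, and since \<open>R \<ge> 0\<close> it is bounded below by \<open>- q(a)\<close>. This is where the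
  hypothesis enters: \<open>q\<close> increases to the right of \<open>a\<close> and has a root there or at \<open>a\<close>, so
  \<open>q(a) \<le> 0\<close>, with strict inequality for \<open>q = p\<close>, which makes the conclusions for \<open>p\<close> strict.
\<close>

section \<open>Log-concavity ratios of right-Noetherian polynomials\<close>

text \<open>
  The derivative of the log-concavity ratio, cleared of its denominator \<open>q'\<^sup>3\<close>.
\<close>
definition ratio_deriv_numerator :: "real poly \<Rightarrow> real \<Rightarrow> real" where
  "ratio_deriv_numerator q x =
     (poly (pderiv q) x)^2 * poly (pderiv (pderiv q)) x
     + poly q x * poly (pderiv q) x * poly (pderiv (pderiv (pderiv q))) x
     - 2 * poly q x * (poly (pderiv (pderiv q)) x)^2"

lemma DERIV_log_concavity_ratio:
  assumes "poly (pderiv q) x \<noteq> 0"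
  shows "(log_concavity_ratio q has_real_derivative
            ratio_deriv_numerator q x / (poly (pderiv q) x)^3) (at x)"
proof -
  have "((\<lambda>x. poly q x * poly (pderiv (pderiv q)) x / (poly (pderiv q) x)^2)
      has_real_derivative ratio_deriv_numerator q x / (poly (pderiv q) x)^3) (at x)"
    unfolding ratio_deriv_numerator_def
    using assms
    by (auto intro!: derivative_eq_intros)
      (simp add: divide_simps, simp add: algebra_simps eval_nat_numeral)
  then show ?thesis by (simp add: log_concavity_ratio_def[abs_def])
qed

text \<open>
  Nothing is assumed about \<open>R\<close> at \<open>a\<close> itself: in the applications \<open>R\<close> is a quotient whose
  denominator may vanish there, so the bound is reached as a limit from the right.
\<close>
lemma nondecreasing_difference_lower_bound:
  fixes q R :: "real \<Rightarrow> real"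
  assumes cont: "isCont q a"
    and R: "\<And>x. a < x \<Longrightarrow> 0 \<le> R x"
    and der: "\<And>x. a < x \<Longrightarrow> \<exists>d\<ge>0. ((\<lambda>x. R x - q x) has_real_derivative d) (at x)"
    and x: "a < x"
  shows "- q a \<le> R x - q x"
proof -
  have "- q y \<le> R x - q x" if y: "a < y" "y < x" for y
  proof -
    have "R y - q y \<le> R x - q x"
      using y der by (intro DERIV_nonneg_imp_nondecreasing[of y x "\<lambda>x. R x - q x"])
        (auto, meson less_le_trans)
    then show ?thesis using R[of y] y by linarith
  qed
  then have ev: "eventually (\<lambda>y. - q y \<le> R x - q x) (at_right a)"
    using x by (auto simp: eventually_at_right_field)
  have "((\<lambda>y. - q y) \<longlongrightarrow> - q a) (at_right a)"
    using cont by (intro tendsto_minus) (auto simp: isCont_def filterlim_at_split)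
  then show ?thesis
    using ev by (rule tendsto_upperbound) simp
qed

text \<open>
  This is \<open>R - q \<ge> - q(a)\<close> for \<open>R = (m - 1) q'\<^sup>2 / (m q'')\<close>, multiplied by \<open>m q''\<close>. The derivative
  of \<open>R - q\<close> is \<open>q' / (m q''\<^sup>2)\<close> times the difference of the two sides of the hypothesis, which is
  the claim for \<open>q'\<close> and \<open>m - 1\<close>.
\<close>
lemma discriminant_bound_step:
  fixes q :: "real poly" and m :: real
  assumes m: "1 \<le> m"
    and q1: "\<And>x. a < x \<Longrightarrow> 0 < poly (pderiv q) x"
    and q2: "\<And>x. a < x \<Longrightarrow> 0 < poly (pderiv (pderiv q)) x"
    and IH: "\<And>x. a < x \<Longrightarrow>
      (m - 1) * (poly (pderiv q) x * poly (pderiv (pderiv (pderiv q))) x)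
        \<le> (m - 2) * (poly (pderiv (pderiv q)) x)^2"
    and x: "a < x"
  shows "- m * poly q a * poly (pderiv (pderiv q)) x \<le>
    (m - 1) * (poly (pderiv q) x)^2 - m * (poly q x * poly (pderiv (pderiv q)) x)"
proof -
  have "0 < m" using m by simp
  define R where "R x = (m - 1) / m * ((poly (pderiv q) x)^2 / poly (pderiv (pderiv q)) x)" for x
  have "- poly q a \<le> R x - poly q x"
  proof (rule nondecreasing_difference_lower_bound[where q = "poly q" and R = R])
    fix y assume y: "a < y"
    show "0 \<le> R y" using q2[OF y] m by (simp add: R_def)
    let ?a = "poly (pderiv q) y" and ?b = "poly (pderiv (pderiv q)) y"
      and ?c = "poly (pderiv (pderiv (pderiv q))) y"
    have "((\<lambda>x. R x - poly q x) has_real_derivative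
        ?a * ((m - 2) * ?b^2 - (m - 1) * (?a * ?c)) / (m * ?b^2)) (at y)"
      unfolding R_def using q2[OF y] \<open>0 < m\<close>
      by (auto intro!: derivative_eq_intros)
        (simp add: divide_simps power2_eq_square, simp add: algebra_simps)
    moreover have "0 \<le> ?a * ((m - 2) * ?b^2 - (m - 1) * (?a * ?c)) / (m * ?b^2)"
      using q1[OF y] IH[OF y] \<open>0 < m\<close> by simp
    ultimately show "\<exists>d\<ge>0. ((\<lambda>x. R x - poly q x) has_real_derivative d) (at y)" by blast
  qed (use x in auto)
  then have "- poly q a * (m * poly (pderiv (pderiv q)) x)
      \<le> (R x - poly q x) * (m * poly (pderiv (pderiv q)) x)"
    using q2[OF x] \<open>0 < m\<close> by (intro mult_right_mono) auto
  also have "\<dots> = (m - 1) * (poly (pderiv q) x)^2 - m * (poly q x * poly (pderiv (pderiv q)) x)"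
    using q2[OF x] \<open>0 < m\<close> by (simp add: R_def field_simps)
  finally show ?thesis by (simp add: algebra_simps)
qed

text \<open>
  The function \<open>R = q'\<^sup>2 q'' / S\<close> is chosen so that \<open>(R - q) S\<close> is the numerator for \<open>q\<close>; its virtue
  is that \<open>(R - q)'\<close> is \<open>q'\<^sup>2 / S\<^sup>2\<close> times the numerator for \<open>q'\<close>. In terms of \<open>u = q / q'\<close> and
  \<open>v = q' / q''\<close> one has \<open>R = q' v / (1 + v')\<close>; if \<open>q(a) \<le> 0\<close>, the lemma passes concavity from
  \<open>v\<close> to \<open>u\<close>.
\<close>
lemma ratio_deriv_numerator_step:
  fixes q :: "real poly"
  defines "S \<equiv> \<lambda>x. 2 * (poly (pderiv (pderiv q)) x)^2
                     - poly (pderiv q) x * poly (pderiv (pderiv (pderiv q))) x"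
  assumes q2: "\<And>x. a < x \<Longrightarrow> 0 < poly (pderiv (pderiv q)) x"
    and S: "\<And>x. a < x \<Longrightarrow> 0 < S x"
    and IH: "\<And>x. a < x \<Longrightarrow> 0 \<le> ratio_deriv_numerator (pderiv q) x"
    and x: "a < x"
  shows "- poly q a * S x \<le> ratio_deriv_numerator q x"
proof -
  define R where "R x = (poly (pderiv q) x)^2 * poly (pderiv (pderiv q)) x / S x" for x
  have "- poly q a \<le> R x - poly q x"
  proof (rule nondecreasing_difference_lower_bound[where q = "poly q" and R = R])
    fix y assume y: "a < y"
    show "0 \<le> R y" using q2[OF y] S[OF y] by (simp add: R_def)
    have S': "(S has_real_derivative
        3 * poly (pderiv (pderiv q)) y * poly (pderiv (pderiv (pderiv q))) y
        - poly (pderiv q) y * poly (pderiv (pderiv (pderiv (pderiv q)))) y) (at y)"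
      unfolding S_def by (auto intro!: derivative_eq_intros)
    have "((\<lambda>x. R x - poly q x) has_real_derivative
        (poly (pderiv q) y)^2 * ratio_deriv_numerator (pderiv q) y / (S y)^2) (at y)"
      unfolding R_def using S[OF y]
      by (auto intro!: derivative_eq_intros S')
        (simp add: divide_simps, simp add: S_def ratio_deriv_numerator_def power2_eq_square,
          simp add: algebra_simps)
    then show "\<exists>d\<ge>0. ((\<lambda>x. R x - poly q x) has_real_derivative d) (at y)"
      using IH[OF y] by (intro exI conjI) auto
  qed (use x in auto)
  then have "- poly q a * S x \<le> (R x - poly q x) * S x"
    using S[OF x] by (intro mult_right_mono) auto
  also have "\<dots> = ratio_deriv_numerator q x"
    using S[OF x] by (simp add: R_def left_diff_distrib)
      (simp add: S_def ratio_deriv_numerator_def power2_eq_square algebra_simps)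
  finally show ?thesis .
qed

lemma right_noetherian_pderiv:
  assumes "right_noetherian q"
  shows "right_noetherian (pderiv q)"
  unfolding right_noetherian_def
proof (intro allI impI)
  fix k assume "k + 2 \<le> degree (pderiv q)"
  then have "Suc k + 2 \<le> degree q" by (simp add: degree_pderiv)
  then show "\<exists>x y. is_largest_real_root ((pderiv ^^ Suc k) (pderiv q)) y \<and>
      poly ((pderiv ^^ k) (pderiv q)) x = 0 \<and> y \<le> x"
    using assms unfolding right_noetherian_def
    by (metis funpow_Suc_right o_apply)
qed

lemma largest_real_root_unique:
  "is_largest_real_root p x \<Longrightarrow> is_largest_real_root p y \<Longrightarrow> x = y"
  by (auto simp: is_largest_real_root_def intro: antisym)

lemma poly_increasing_right_of:
  fixes q :: "real poly"
  assumes "\<And>x. a < x \<Longrightarrow> 0 < poly (pderiv q) x" "a < x"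
  shows "poly q a < poly q x"
  by (rule DERIV_pos_imp_increasing_open[OF assms(2)])
    (use assms(1) poly_DERIV[of q] in blast, intro continuous_intros)

text \<open>
  The last two conclusions keep the term \<open>- q(a)\<close>, so that the sign of \<open>q(a)\<close> alone decides between
  the weak inequalities, on which the induction runs, and the strict ones for the polynomial itself.
\<close>
lemma noetherian_inequalities_step:
  fixes q :: "real poly"
  assumes deg: "2 \<le> degree q"
    and root: "poly (pderiv q) a = 0"
    and IH: "\<forall>x>a. 0 < poly (pderiv (pderiv q)) x \<and>
       (real (degree q) - 1) * (poly (pderiv q) x * poly (pderiv (pderiv (pderiv q))) x)
          \<le> (real (degree q) - 2) * (poly (pderiv (pderiv q)) x)^2 \<and>
       0 \<le> ratio_deriv_numerator (pderiv q) x"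
    and x: "a < x"
  shows "0 < poly (pderiv q) x"
    and "- real (degree q) * poly q a * poly (pderiv (pderiv q)) x \<le>
          (real (degree q) - 1) * (poly (pderiv q) x)^2
          - real (degree q) * (poly q x * poly (pderiv (pderiv q)) x)"
    and "\<exists>s>0. - poly q a * s \<le> ratio_deriv_numerator q x"
proof -
  have q1: "0 < poly (pderiv q) x" if "a < x" for x
    using poly_increasing_right_of[of a "pderiv q" x] IH that root by auto
  show "0 < poly (pderiv q) x" using q1 x .
  show "- real (degree q) * poly q a * poly (pderiv (pderiv q)) x \<le>
          (real (degree q) - 1) * (poly (pderiv q) x)^2
          - real (degree q) * (poly q x * poly (pderiv (pderiv q)) x)"
    using discriminant_bound_step[of "real (degree q)" a q x] deg q1 IH x by auto
  \<comment> \<open>The bound on \<open>q' q'''\<close> makes the denominator of the second auxiliary quotient positive.\<close>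
  have S: "0 < 2 * (poly (pderiv (pderiv q)) x)^2
      - poly (pderiv q) x * poly (pderiv (pderiv (pderiv q))) x" if "a < x" for x
  proof -
    let ?m = "real (degree q)" and ?b = "(poly (pderiv (pderiv q)) x)^2"
      and ?ac = "poly (pderiv q) x * poly (pderiv (pderiv (pderiv q))) x"
    have b: "0 < ?b" using IH[rule_format, OF that] by simp
    have "(?m - 1) * ?ac \<le> (?m - 2) * ?b" using IH[rule_format, OF that] by blast
    also have "\<dots> < (?m - 1) * (2 * ?b)" using b deg by (simp add: algebra_simps)
    finally show ?thesis using deg by (simp add: mult_less_cancel_left)
  qed
  show "\<exists>s>0. - poly q a * s \<le> ratio_deriv_numerator q x"
    using ratio_deriv_numerator_step[of a q x] IH S x by blast
qed

lemma right_noetherian_critical_pointE: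
  assumes "right_noetherian q" "2 \<le> degree q"
  obtains r y where "is_largest_real_root (pderiv q) y" "poly q r = 0" "y \<le> r"
  using assms(1)[unfolded right_noetherian_def, rule_format, of 0] assms(2) that by auto

text \<open>
  Passing to the derivative can only enlarge the half-line on which the inequalities are claimed.
  A polynomial of degree at most one has no isolated critical point, and \<open>b\<close> is then arbitrary.
\<close>
lemma right_noetherian_critical_point_le:
  assumes "right_noetherian q" "is_largest_real_root q a"
  obtains b where "b \<le> a" "2 \<le> degree q \<Longrightarrow> is_largest_real_root (pderiv q) b"
proof (cases "2 \<le> degree q")
  case True
  with assms(1) obtain r b where "is_largest_real_root (pderiv q) b" "poly q r = 0" "b \<le> r"
    by (rule right_noetherian_critical_pointE)
  with assms(2) show ?thesis
    by (intro that[of b]) (auto simp: is_largest_real_root_def)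
qed (use that in auto)

lemma right_noetherian_nonpos_at_critical:
  fixes q :: "real poly"
  assumes "right_noetherian q" "2 \<le> degree q" "is_largest_real_root (pderiv q) a"
    and pos: "\<And>x. a < x \<Longrightarrow> 0 < poly (pderiv q) x"
  shows "poly q a \<le> 0"
proof -
  obtain r y where "is_largest_real_root (pderiv q) y" "poly q r = 0" "y \<le> r"
    using assms(1,2) by (rule right_noetherian_critical_pointE)
  then have "poly q r = 0" "a \<le> r"
    using largest_real_root_unique[OF assms(3)] by auto
  then show ?thesis
    using poly_increasing_right_of[of a q r] pos by (cases "a = r") auto
qed

text \<open>
  The induction starts at degree one, where \<open>q'\<close> is a positive constant without roots and the
  inequalities hold on the whole line; accordingly \<open>a\<close> is only constrained from degree two on.
\<close>
lemma right_noetherian_inequalities: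
  fixes q :: "real poly"
  assumes "right_noetherian q" "1 \<le> degree q" "0 < lead_coeff q"
    and "2 \<le> degree q \<Longrightarrow> is_largest_real_root (pderiv q) a"
    and "a < x"
  shows "0 < poly (pderiv q) x \<and> 0 \<le> poly (pderiv (pderiv q)) x \<and>
    real (degree q) * (poly q x * poly (pderiv (pderiv q)) x)
      \<le> (real (degree q) - 1) * (poly (pderiv q) x)^2 \<and>
    0 \<le> ratio_deriv_numerator q x"
  using assms
proof (induction "degree q" arbitrary: q a x)
  case 0
  then show ?case by simp
next
  case (Suc m)
  show ?case
  proof (cases "m = 0")
    case True
    then have d: "degree q = 1" using Suc.hyps(2) by simp
    then obtain s t where q: "q = [:s, t:]" by (metis degree_eq_zeroE degree_pCons_eq_if One_nat_def nat.inject pCons_cases zero_neq_one)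
    have "0 < t" using Suc.prems(3) d q by simp
    then show ?thesis using d
      by (simp add: q pderiv_pCons ratio_deriv_numerator_def)
  next
    case False
    have deg: "2 \<le> degree q" and dq: "degree (pderiv q) = m"
      using False Suc.hyps(2) by (auto simp: degree_pderiv)
    have root: "is_largest_real_root (pderiv q) a" using Suc.prems(4) deg .
    have rn: "right_noetherian (pderiv q)" using Suc.prems(1) by (rule right_noetherian_pderiv)
    have lc: "0 < lead_coeff (pderiv q)"
      using Suc.prems(3) Suc.hyps(2) by (simp add: dq coeff_pderiv)
    obtain b where b: "b \<le> a" "2 \<le> degree (pderiv q) \<Longrightarrow> is_largest_real_root (pderiv (pderiv q)) b"
      using rn root by (rule right_noetherian_critical_point_le) blast
    have IH: "\<forall>x>a. 0 < poly (pderiv (pderiv q)) x \<and>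
       (real (degree q) - 1) * (poly (pderiv q) x * poly (pderiv (pderiv (pderiv q))) x)
          \<le> (real (degree q) - 2) * (poly (pderiv (pderiv q)) x)^2 \<and>
       0 \<le> ratio_deriv_numerator (pderiv q) x"
      using Suc.hyps(1)[of "pderiv q" b] rn lc b False dq Suc.hyps(2)[symmetric] by simp
    have r0: "poly (pderiv q) a = 0" using root by (simp add: is_largest_real_root_def)
    note step = noetherian_inequalities_step[OF deg r0 IH]
    have q1: "0 < poly (pderiv q) y" if "a < y" for y using step(1) that .
    have np: "poly q a \<le> 0"
      using right_noetherian_nonpos_at_critical Suc.prems(1) deg root q1 .
    have "0 \<le> - real (degree q) * poly q a * poly (pderiv (pderiv q)) x"
      using np IH[rule_format, OF \<open>a < x\<close>] by (simp add: mult_nonneg_nonpos mult_nonpos_nonneg)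
    also note step(2)[OF \<open>a < x\<close>]
    finally have E: "real (degree q) * (poly q x * poly (pderiv (pderiv q)) x)
      \<le> (real (degree q) - 1) * (poly (pderiv q) x)^2" by simp
    obtain s where s: "s > 0" "- poly q a * s \<le> ratio_deriv_numerator q x"
      using step(3)[OF \<open>a < x\<close>] by blast
    have "0 \<le> - poly q a * s" using s np by (simp add: mult_nonpos_nonneg)
    then show ?thesis using q1 IH E s \<open>a < x\<close> by (auto intro: less_imp_le)
  qed
qed

lemma strictly_right_noetherian_inequalities:
  fixes q :: "real poly"
  assumes srn: "strictly_right_noetherian q" and deg: "2 \<le> degree q" and lc: "0 < lead_coeff q"
    and root: "is_largest_real_root (pderiv q) a"
    and x: "a < x"
  shows "0 < poly (pderiv q) x" (is ?pos1)
    and "0 < poly (pderiv (pderiv q)) x" (is ?pos2)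
    and "0 \<le> poly (pderiv (pderiv (pderiv q))) x" (is ?nonneg3)
    and "(real (degree q) - 1) * (poly (pderiv q) x * poly (pderiv (pderiv (pderiv q))) x)
          \<le> (real (degree q) - 2) * (poly (pderiv (pderiv q)) x)^2" (is ?E1)
    and "real (degree q) * (poly q x * poly (pderiv (pderiv q)) x)
          < (real (degree q) - 1) * (poly (pderiv q) x)^2" (is ?E0)
    and "0 < ratio_deriv_numerator q x" (is ?M)
proof -
  have rn: "right_noetherian q" using srn by (simp add: strictly_right_noetherian_def)
  have rn': "right_noetherian (pderiv q)" using rn by (rule right_noetherian_pderiv)
  have dq: "degree (pderiv q) = degree q - 1" by (simp add: degree_pderiv)
  have lc': "0 < lead_coeff (pderiv q)"
    using lc deg by (simp add: dq coeff_pderiv)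
  obtain b where b: "b \<le> a" "2 \<le> degree (pderiv q) \<Longrightarrow> is_largest_real_root (pderiv (pderiv q)) b"
      using rn' root by (rule right_noetherian_critical_point_le) blast
  have IH: "\<forall>x>a. 0 < poly (pderiv (pderiv q)) x \<and>
       (real (degree q) - 1) * (poly (pderiv q) x * poly (pderiv (pderiv (pderiv q))) x)
          \<le> (real (degree q) - 2) * (poly (pderiv (pderiv q)) x)^2 \<and>
       0 \<le> ratio_deriv_numerator (pderiv q) x"
    and nonneg3: "\<forall>x>a. 0 \<le> poly (pderiv (pderiv (pderiv q))) x"
    using right_noetherian_inequalities[of "pderiv q" b] rn' lc' b deg
    by (simp_all add: dq of_nat_diff)
  have r0: "poly (pderiv q) a = 0" using root by (simp add: is_largest_real_root_def)
  note step = noetherian_inequalities_step[OF deg r0 IH]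
  show ?pos1 using step(1)[OF x] .
  show ?pos2 ?nonneg3 ?E1 using IH nonneg3 x by auto
  obtain r where r: "poly q r = 0" "a < r"
    using srn largest_real_root_unique[OF root]
    unfolding strictly_right_noetherian_def is_largest_real_root_def by auto
  have neg: "poly q a < 0"
    using poly_increasing_right_of[of a q r] step(1) r by auto
  have "0 < - real (degree q) * poly q a * poly (pderiv (pderiv q)) x"
    using neg deg \<open>?pos2\<close> by (simp add: mult_neg_pos mult_pos_neg)
  also note step(2)[OF x]
  finally show ?E0 by simp
  obtain s where s: "s > 0" "- poly q a * s \<le> ratio_deriv_numerator q x"
    using step(3)[OF x] by blast
  have "0 < - poly q a * s" using s neg by (simp add: mult_neg_pos)
  then show ?M using s by linarith
qed



section \<open>Symmetric multilinear polynomials\<close>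

text \<open>
  Indexing by subsets instead of by degrees makes the dependence on a single variable visible: in
  \<open>v j\<close> the polynomial is affine, and its slope is the polynomial of the same kind in the
  other variables with the coefficient sequence shifted by one. Hence all partial derivatives
  stay within this family.
\<close>
definition sym_multilinear :: "(nat \<Rightarrow> real) \<Rightarrow> nat set \<Rightarrow> (nat \<Rightarrow> real) \<Rightarrow> real" where
  "sym_multilinear a J v = (\<Sum>S\<in>Pow J. a (card S) * (\<Prod>i\<in>S. v i))"

lemma sym_multilinear_cong:
  "(\<And>i. i \<in> J \<Longrightarrow> v i = w i) \<Longrightarrow> sym_multilinear a J v = sym_multilinear a J w"
  unfolding sym_multilinear_def by (intro sum.cong arg_cong2[of _ _ _ _ "(*)"] prod.cong) auto

lemma sym_multilinear_esym:
  assumes "finite J"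
  shows "sym_multilinear a J v = (\<Sum>k\<le>card J. a k * esym J k v)"
proof -
  have "sym_multilinear a J v
      = (\<Sum>k\<le>card J. \<Sum>S\<in>{S \<in> Pow J. card S = k}. a (card S) * (\<Prod>i\<in>S. v i))"
    unfolding sym_multilinear_def using assms
    by (intro sum.group[symmetric]) (auto intro: card_mono)
  also have "\<dots> = (\<Sum>k\<le>card J. a k * esym J k v)"
    unfolding esym_def sum_distrib_left by (intro sum.cong) auto
  finally show ?thesis .
qed

lemma sym_multilinear_insert:
  assumes "finite J" "j \<notin> J"
  shows "sym_multilinear a (insert j J) v
    = sym_multilinear a J v + v j * sym_multilinear (a \<circ> Suc) J v"
proof -
  have inj: "inj_on (insert j) (Pow J)" using assms by (auto simp: inj_on_def)
  have "sym_multilinear a (insert j J) v = sym_multilinear a J v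
      + (\<Sum>S\<in>Pow J. a (card (insert j S)) * (\<Prod>i\<in>insert j S. v i))"
    unfolding sym_multilinear_def Pow_insert using assms inj
    by (subst sum.union_disjoint) (auto simp: sum.reindex)
  also have "(\<Sum>S\<in>Pow J. a (card (insert j S)) * (\<Prod>i\<in>insert j S. v i))
      = v j * sym_multilinear (a \<circ> Suc) J v"
    unfolding sym_multilinear_def sum_distrib_left
  proof (rule sum.cong)
    fix S assume "S \<in> Pow J"
    then have "finite S" "j \<notin> S" using assms by (auto dest: finite_subset)
    then show "a (card (insert j S)) * (\<Prod>i\<in>insert j S. v i)
        = v j * ((a \<circ> Suc) (card S) * (\<Prod>i\<in>S. v i))" by simp
  qed simp
  finally show ?thesis .
qed

lemma DERIV_sym_multilinear:
  assumes "finite J"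
  shows "((\<lambda>t. sym_multilinear a J (v(i := t))) has_real_derivative
           (if i \<in> J then sym_multilinear (a \<circ> Suc) (J - {i}) v else 0)) (at t)"
proof (cases "i \<in> J")
  case True
  have "sym_multilinear a J (v(i := t)) =
      sym_multilinear a (J - {i}) v + t * sym_multilinear (a \<circ> Suc) (J - {i}) v" for t
    using sym_multilinear_insert[of "J - {i}" i a "v(i := t)"] assms True
      sym_multilinear_cong[of "J - {i}" "v(i := t)" v] by (simp add: insert_absorb)
  then show ?thesis using True by (auto intro!: derivative_eq_intros)
next
  case False
  then have "sym_multilinear a J (v(i := t)) = sym_multilinear a J v" for t
    by (intro sym_multilinear_cong) auto
  with False show ?thesis by simp
qed

text \<open>
  By Pascal's rule this is \<open>\<Sum>j\<le>k. (k choose j) a\<^sub>j x\<^sup>j\<close>. The recursion splits off one variable, as in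
  \<open>sym_multilinear_insert\<close>.
\<close>
fun diagonal_poly :: "(nat \<Rightarrow> real) \<Rightarrow> nat \<Rightarrow> real poly" where
  "diagonal_poly a 0 = [:a 0:]"
| "diagonal_poly a (Suc k) = diagonal_poly a k + pCons 0 (diagonal_poly (a \<circ> Suc) k)"

lemma sym_multilinear_diagonal:
  assumes "finite J" "\<And>i. i \<in> J \<Longrightarrow> v i = x"
  shows "sym_multilinear a J v = poly (diagonal_poly a (card J)) x"
  using assms
proof (induction J arbitrary: a)
  case empty
  then show ?case by (simp add: sym_multilinear_def)
next
  case (insert j J)
  then show ?case by (simp add: sym_multilinear_insert)
qed

lemma pderiv_diagonal_poly:
  "pderiv (diagonal_poly a (Suc k)) = smult (real (Suc k)) (diagonal_poly (a \<circ> Suc) k)"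
proof (induction k arbitrary: a)
  case 0
  then show ?case by (simp add: pderiv_pCons pderiv_add)
next
  case (Suc k)
  have "pderiv (diagonal_poly a (Suc (Suc k))) = pderiv (diagonal_poly a (Suc k))
      + (diagonal_poly (a \<circ> Suc) (Suc k) + pCons 0 (pderiv (diagonal_poly (a \<circ> Suc) (Suc k))))"
    by (subst diagonal_poly.simps(2)) (simp only: pderiv_add pderiv_pCons)
  also have "\<dots> = smult (real (Suc k)) (diagonal_poly (a \<circ> Suc) (Suc k))
      + diagonal_poly (a \<circ> Suc) (Suc k)"
    unfolding Suc.IH by (intro poly_eq_poly_eq_iff[THEN iffD1] ext) (simp add: algebra_simps)
  also have "\<dots> = smult (real (Suc (Suc k))) (diagonal_poly (a \<circ> Suc) (Suc k))"
    by (intro poly_eq_poly_eq_iff[THEN iffD1] ext) (simp add: algebra_simps)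
  finally show ?case .
qed

definition inv_sigma_coeff :: "nat \<Rightarrow> (nat \<Rightarrow> real) \<Rightarrow> nat \<Rightarrow> real" where
  "inv_sigma_coeff n c k = (if k = n then 1 else - c k)"

lemma esym_card: "finite J \<Longrightarrow> esym J (card J) v = (\<Prod>i\<in>J. v i)"
proof -
  assume "finite J"
  then have "{S. S \<subseteq> J \<and> card S = card J} = {J}"
    by (auto dest: card_subset_eq)
  then show ?thesis by (simp add: esym_def)
qed

lemma inv_sigma_sym_multilinear:
  "inv_sigma n c v = sym_multilinear (inv_sigma_coeff n c) {1..n} v"
proof -
  have "sym_multilinear (inv_sigma_coeff n c) {1..n} v
      = (\<Sum>k<Suc n. inv_sigma_coeff n c k * esym {1..n} k v)"
    by (simp add: sym_multilinear_esym lessThan_Suc_atMost)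
  also have "\<dots> = esym {1..n} n v + (\<Sum>k<n. - c k * esym {1..n} k v)"
    by (simp add: inv_sigma_coeff_def)
  finally show ?thesis
    using esym_card[of "{1..n}" v] by (simp add: inv_sigma_def sum_negf)
qed

lemma diag_restriction_diagonal_poly:
  "diag_restriction n c = diagonal_poly (inv_sigma_coeff n c) n"
proof -
  have "poly (diag_restriction n c) x = poly (diagonal_poly (inv_sigma_coeff n c) n) x" for x
    using inv_sigma_diagonal[of n c x] sym_multilinear_diagonal[of "{1..n}" "\<lambda>_. x" x]
    by (simp add: inv_sigma_sym_multilinear)
  then show ?thesis by (intro poly_eq_poly_eq_iff[THEN iffD1] ext)
qed

lemma last_coord_sym_multilinear:
  assumes "n = Suc m"
  shows "last_coord n c v = - sym_multilinear (inv_sigma_coeff n c) {1..m} v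
          / sym_multilinear (inv_sigma_coeff n c \<circ> Suc) {1..m} v"
proof -
  have num: "sym_multilinear (inv_sigma_coeff n c) {1..m} v
      = - (\<Sum>k\<in>{0..m}. c k * esym {1..m} k v)"
    using assms by (simp add: sym_multilinear_esym inv_sigma_coeff_def sum_negf[symmetric]
        atLeast0AtMost del: sum_negf)
  have "sym_multilinear (inv_sigma_coeff n c \<circ> Suc) {1..m} v
      = (\<Sum>k<Suc m. inv_sigma_coeff n c (Suc k) * esym {1..m} k v)"
    by (simp add: sym_multilinear_esym lessThan_Suc_atMost)
  also have "\<dots> = esym {1..m} m v - (\<Sum>k<m. c (Suc k) * esym {1..m} k v)"
    using assms by (simp add: inv_sigma_coeff_def sum_negf)
  also have "(\<Sum>k<m. c (Suc k) * esym {1..m} k v) = (\<Sum>k\<in>{1..m}. c k * esym {1..m} (k - 1) v)"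
    by (rule sum.reindex_bij_witness[of _ "\<lambda>k. k - 1" Suc]) auto
  also have "esym {1..m} m v - (\<Sum>k\<in>{1..m}. c k * esym {1..m} (k - 1) v) = last_coord_denom n c v"
    using assms esym_card[of "{1..m}" v] by (simp add: last_coord_denom_def)
  finally have den:
    "sym_multilinear (inv_sigma_coeff n c \<circ> Suc) {1..m} v = last_coord_denom n c v" .
  show ?thesis unfolding num den last_coord_def using assms by simp
qed

section \<open>The Hessian of a quotient of multilinear polynomials\<close>

lemma partial_eqI:
  "((\<lambda>t. g (v(i := t))) has_real_derivative d) (at (v i)) \<Longrightarrow> partial i g v = d"
  unfolding partial_def by (rule DERIV_imp_deriv)

lemma partial_sym_multilinear_quotient:
  assumes "finite J" "j \<in> J" and V: "sym_multilinear b J v \<noteq> 0"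
  shows "partial j (\<lambda>v. - sym_multilinear a J v / sym_multilinear b J v) v =
    - (sym_multilinear (a \<circ> Suc) (J - {j}) v * sym_multilinear b J v
        - sym_multilinear a J v * sym_multilinear (b \<circ> Suc) (J - {j}) v)
      / (sym_multilinear b J v)^2"
proof -
  have U': "((\<lambda>t. sym_multilinear a J (v(j := t))) has_real_derivative
        sym_multilinear (a \<circ> Suc) (J - {j}) v) (at (v j))"
    and V': "((\<lambda>t. sym_multilinear b J (v(j := t))) has_real_derivative
        sym_multilinear (b \<circ> Suc) (J - {j}) v) (at (v j))"
    using DERIV_sym_multilinear[of J _ v j "v j"] assms by auto
  show ?thesis
    using DERIV_divide[OF DERIV_minus[OF U'] V'] V
    by (intro partial_eqI) (simp add: power2_eq_square algebra_simps)
qed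

text \<open>
  The second-order coefficients vanish for \<open>i = j\<close> because numerator and denominator are affine in
  each variable.
\<close>
lemma hessian_sym_multilinear_quotient:
  fixes a b v :: "nat \<Rightarrow> real" and U V U2 V2 :: real and U1 V1 :: "nat \<Rightarrow> real"
  assumes J: "finite J" "i \<in> J" "j \<in> J" and nz: "sym_multilinear b J v \<noteq> 0"
  defines "U \<equiv> sym_multilinear a J v" and "V \<equiv> sym_multilinear b J v"
    and "U1 \<equiv> \<lambda>k. sym_multilinear (a \<circ> Suc) (J - {k}) v"
    and "V1 \<equiv> \<lambda>k. sym_multilinear (b \<circ> Suc) (J - {k}) v"
    and "U2 \<equiv> if i = j then 0 else sym_multilinear (a \<circ> Suc \<circ> Suc) (J - {j} - {i}) v"
    and "V2 \<equiv> if i = j then 0 else sym_multilinear (b \<circ> Suc \<circ> Suc) (J - {j} - {i}) v"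
  shows "hessian (\<lambda>v. - sym_multilinear a J v / sym_multilinear b J v) v i j =
    2 * (U1 j * V - U * V1 j) * V1 i / V^3
    - (U2 * V + U1 j * V1 i - U1 i * V1 j - U * V2) / V^2"
proof -
  let ?g = "\<lambda>v. - sym_multilinear a J v / sym_multilinear b J v"
  let ?h = "\<lambda>v. - (sym_multilinear (a \<circ> Suc) (J - {j}) v * sym_multilinear b J v
        - sym_multilinear a J v * sym_multilinear (b \<circ> Suc) (J - {j}) v)
      / (sym_multilinear b J v)^2"
  have dU: "((\<lambda>t. sym_multilinear a J (v(i := t))) has_real_derivative U1 i) (at t)"
    and dV: "((\<lambda>t. sym_multilinear b J (v(i := t))) has_real_derivative V1 i) (at t)"
    and dU1: "((\<lambda>t. sym_multilinear (a \<circ> Suc) (J - {j}) (v(i := t))) has_real_derivative U2) (at t)"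
    and dV1: "((\<lambda>t. sym_multilinear (b \<circ> Suc) (J - {j}) (v(i := t))) has_real_derivative V2) (at t)"
    for t
    using DERIV_sym_multilinear[of J a v i t] DERIV_sym_multilinear[of J b v i t]
      DERIV_sym_multilinear[of "J - {j}" "a \<circ> Suc" v i t]
      DERIV_sym_multilinear[of "J - {j}" "b \<circ> Suc" v i t] J
    by (auto simp: U1_def V1_def U2_def V2_def split: if_splits)
  have "isCont (\<lambda>t. sym_multilinear b J (v(i := t))) (v i)"
    using dV by (rule DERIV_isCont)
  then have "((\<lambda>t. sym_multilinear b J (v(i := t))) \<longlongrightarrow> V) (nhds (v i))"
    by (simp add: isCont_def tendsto_nhds_iff V_def)
  then have "\<forall>\<^sub>F t in nhds (v i). sym_multilinear b J (v(i := t)) \<noteq> 0"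
    using nz unfolding V_def by (rule tendsto_imp_eventually_ne)
  \<comment> \<open>The formula for the first partial derivative presupposes a nonzero denominator, so it can be
    differentiated only after it has been established on a neighbourhood of \<open>v i\<close>.\<close>
  then have ev: "\<forall>\<^sub>F t in nhds (v i). partial j ?g (v(i := t)) = ?h (v(i := t))"
    using partial_sym_multilinear_quotient[OF J(1,3)] by (auto elim!: eventually_mono)
  have vals: "sym_multilinear a J v = U" "sym_multilinear b J v = V"
    "sym_multilinear (a \<circ> Suc) (J - {j}) v = U1 j"
    "sym_multilinear (b \<circ> Suc) (J - {j}) v = V1 j"
    by (simp_all add: U_def V_def U1_def V1_def)
  have V: "V \<noteq> 0" using nz by (simp add: V_def)
  have "((\<lambda>t. ?h (v(i := t))) has_real_derivative
    2 * (U1 j * V - U * V1 j) * V1 i / V^3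
    - (U2 * V + U1 j * V1 i - U1 i * V1 j - U * V2) / V^2) (at (v i))"
    by (rule DERIV_cong[OF DERIV_divide[OF DERIV_minus[OF DERIV_diff[OF
          DERIV_mult[OF dU1 dV] DERIV_mult[OF dU dV1]]] DERIV_power[OF dV, where n = 2]]])
      (use V in \<open>simp_all add: vals divide_simps\<close>, simp add: algebra_simps eval_nat_numeral)
  then have "((\<lambda>t. partial j ?g (v(i := t))) has_real_derivative
    2 * (U1 j * V - U * V1 j) * V1 i / V^3
    - (U2 * V + U1 j * V1 i - U1 i * V1 j - U * V2) / V^2) (at (v i))"
    using DERIV_cong_ev[OF refl ev refl] by simp
  then show ?thesis unfolding hessian_def by (rule partial_eqI)
qed

text \<open>
  The eigenvalues are \<open>A - B\<close> on the vectors of sum zero and \<open>A + (card I - 1) B\<close> on the constant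
  vectors. If \<open>B < 0\<close>, the Cauchy-Schwarz inequality bounds the square of the sum in the quadratic
  form.
\<close>
lemma positive_definite_on_equicorrelated:
  assumes "finite I" and M: "\<And>i j. i \<in> I \<Longrightarrow> j \<in> I \<Longrightarrow> M i j = (if i = j then A else B)"
    and "B < A" and "0 < A + (real (card I) - 1) * B"
  shows "positive_definite_on I M"
  unfolding positive_definite_on_def
proof (intro conjI ballI allI impI)
  fix w :: "nat \<Rightarrow> real" assume "\<exists>i\<in>I. w i \<noteq> 0"
  then have pos: "0 < (\<Sum>i\<in>I. (w i)^2)"
    using assms(1) by (metis sum_pos2 zero_le_power2 zero_less_power2)
  have "(\<Sum>i\<in>I. \<Sum>j\<in>I. w i * M i j * w j)
      = (\<Sum>i\<in>I. \<Sum>j\<in>I. B * (w i * w j) + (if i = j then (A - B) * (w i)^2 else 0))"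
    using M by (intro sum.cong) (auto simp: power2_eq_square algebra_simps)
  also have "\<dots> = B * (\<Sum>i\<in>I. w i)^2 + (A - B) * (\<Sum>i\<in>I. (w i)^2)"
  proof -
    have "(\<Sum>i\<in>I. \<Sum>j\<in>I. B * (w i * w j)) = B * (\<Sum>i\<in>I. w i)^2"
      unfolding power2_eq_square sum_product by (simp add: sum_distrib_left)
    then show ?thesis
      using assms(1) by (simp add: sum.distrib flip: sum_distrib_left)
  qed
  also have "0 < \<dots>"
  proof (cases "0 \<le> B")
    case True
    then show ?thesis using pos \<open>B < A\<close> by (simp add: add_nonneg_pos)
  next
    case False
    have "(\<Sum>i\<in>I. w i)^2 \<le> real (card I) * (\<Sum>i\<in>I. (w i)^2)"
      using sum_squared_le_sum_of_squares[of w I] by (simp add: mult.commute)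
    then have "B * (real (card I) * (\<Sum>i\<in>I. (w i)^2)) \<le> B * (\<Sum>i\<in>I. w i)^2"
      using False by (intro mult_left_mono_neg) auto
    moreover have "0 < (A + (real (card I) - 1) * B) * (\<Sum>i\<in>I. (w i)^2)"
      using assms(4) pos by simp
    ultimately show ?thesis by (simp add: algebra_simps)
  qed
  finally show "0 < (\<Sum>i\<in>I. \<Sum>j\<in>I. w i * M i j * w j)" .
qed (use M in auto)


section \<open>The diagonal curve\<close>

lemma degree_diag_restriction: "degree (diag_restriction n c) = n"
  and lead_coeff_diag_restriction: "lead_coeff (diag_restriction n c) = 1"
proof -
  have coeff: "coeff (diag_restriction n c) k = (if k = n then 1 else 0)" if "n \<le> k" for k
    using that by (auto simp: diag_restriction_def coeff_sum intro!: sum.neutral)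
  show deg: "degree (diag_restriction n c) = n"
    by (intro antisym degree_le le_degree) (auto simp: coeff)
  show "lead_coeff (diag_restriction n c) = 1"
    unfolding deg by (simp add: coeff)
qed

text \<open>
  The normalised derivatives \<open>d\<^sub>k\<close> are the values of the \<open>k\<close>-fold shifted symmetric multilinear
  polynomials in \<open>n - k\<close> variables at the diagonal point. With \<open>\<lambda>\<^sub>n = - U / V\<close> one has \<open>V = d\<^sub>1\<close>,
  \<open>V\<^sub>i = d\<^sub>2\<close>, \<open>V\<^sub>i\<^sub>j = d\<^sub>3\<close>, and \<open>U = d\<^sub>0 - x d\<^sub>1\<close>, \<open>U\<^sub>i = d\<^sub>1 - x d\<^sub>2\<close>, \<open>U\<^sub>i\<^sub>j = d\<^sub>2 - x d\<^sub>3\<close> for \<open>i \<noteq> j\<close>;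
  all explicit occurrences of \<open>x\<close> then cancel. For \<open>n = 2\<close> the division by zero in \<open>d3\<close> is
  harmless, as there are no off-diagonal entries.
\<close>
lemma hessian_last_coord_diagonal:
  fixes n :: nat and c v :: "nat \<Rightarrow> real" and x :: real
  defines "p \<equiv> diag_restriction n c"
  defines "d0 \<equiv> poly p x"
    and "d1 \<equiv> poly (pderiv p) x / real n"
    and "d2 \<equiv> poly (pderiv (pderiv p)) x / (real n * (real n - 1))"
    and "d3 \<equiv> poly (pderiv (pderiv (pderiv p))) x / (real n * (real n - 1) * (real n - 2))"
  assumes n: "2 \<le> n" and v: "\<And>i. i \<in> {1..n-1} \<Longrightarrow> v i = x" and nz: "poly (pderiv p) x \<noteq> 0"
    and ij: "i \<in> {1..n-1}" "j \<in> {1..n-1}"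
  shows "hessian (last_coord n c) v i j =
    2 * d2 * (d1^2 - d0 * d2) / d1^3 - (if i = j then 0 else (d1 * d2 - d0 * d3) / d1^2)"
proof -
  define k where "k = n - 2"
  have nk: "n = Suc (Suc k)" using n by (simp add: k_def)
  define a where "a = inv_sigma_coeff n c"
  have p: "p = diagonal_poly a (Suc (Suc k))"
    by (simp add: p_def a_def diag_restriction_diagonal_poly nk)
  have p1: "pderiv p = smult (real n) (diagonal_poly (a \<circ> Suc) (Suc k))"
    unfolding p pderiv_diagonal_poly by (simp add: nk)
  have p2: "pderiv (pderiv p) = smult (real n * (real n - 1)) (diagonal_poly (a \<circ> Suc \<circ> Suc) k)"
    unfolding p1 pderiv_smult pderiv_diagonal_poly by (simp add: nk)
  have d1: "poly (diagonal_poly (a \<circ> Suc) (Suc k)) x = d1"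
    by (simp only: d1_def p1 poly_smult) (simp add: nk)
  have d2: "poly (diagonal_poly (a \<circ> Suc \<circ> Suc) k) x = d2"
    by (simp only: d2_def p2 poly_smult) (simp add: nk)
  have d3: "poly (diagonal_poly (a \<circ> Suc \<circ> Suc \<circ> Suc) l) x = d3" if "k = Suc l" for l
  proof -
    have "pderiv (pderiv (pderiv p)) = smult (real n * (real n - 1) * (real n - 2))
        (diagonal_poly (a \<circ> Suc \<circ> Suc \<circ> Suc) l)"
      unfolding p2 that pderiv_smult pderiv_diagonal_poly by (simp add: nk that)
    then show ?thesis
      by (simp only: d3_def poly_smult) (simp add: nk that)
  qed
  let ?J = "{1..Suc k}"
  have vJ: "v l = x" if "l \<in> ?J" for l using v that by (simp add: nk)
  have J: "i \<in> ?J" "j \<in> ?J" using ij by (auto simp: nk)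
  have V: "sym_multilinear (a \<circ> Suc) ?J v = d1"
    using sym_multilinear_diagonal[of ?J v x "a \<circ> Suc"] vJ d1 by simp
  have U: "sym_multilinear a ?J v = d0 - x * d1"
  proof -
    have "sym_multilinear a ?J v = poly (diagonal_poly a (Suc k)) x"
      using sym_multilinear_diagonal[of ?J v x a] vJ by simp
    moreover have "d0 = poly (diagonal_poly a (Suc k)) x + x * d1"
      unfolding d0_def p diagonal_poly.simps(2)[of a "Suc k"] d1[symmetric] by simp
    ultimately show ?thesis by simp
  qed
  have V1: "sym_multilinear (a \<circ> Suc \<circ> Suc) (?J - {l}) v = d2" if "l \<in> ?J" for l
    using sym_multilinear_diagonal[of "?J - {l}" v x "a \<circ> Suc \<circ> Suc"] vJ d2 that by simp
  have U1: "sym_multilinear (a \<circ> Suc) (?J - {l}) v = d1 - x * d2" if "l \<in> ?J" for l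
  proof -
    have "sym_multilinear (a \<circ> Suc) (?J - {l}) v = poly (diagonal_poly (a \<circ> Suc) k) x"
      using sym_multilinear_diagonal[of "?J - {l}" v x "a \<circ> Suc"] vJ that by simp
    moreover have "d1 = poly (diagonal_poly (a \<circ> Suc) k) x + x * d2"
      unfolding d1[symmetric] d2[symmetric] by simp
    ultimately show ?thesis by simp
  qed
  have V2: "sym_multilinear (a \<circ> Suc \<circ> Suc \<circ> Suc) (?J - {j} - {i}) v = d3"
    and U2: "sym_multilinear (a \<circ> Suc \<circ> Suc) (?J - {j} - {i}) v = d2 - x * d3"
    if ij_neq: "i \<noteq> j"
  proof -
    obtain l where l: "k = Suc l" using ij_neq J by (cases k) auto
    have card: "card (?J - {j} - {i}) = l" using J that l by simp
    have vJ': "v h = x" if "h \<in> ?J - {j} - {i}" for h using vJ that by blast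
    show "sym_multilinear (a \<circ> Suc \<circ> Suc \<circ> Suc) (?J - {j} - {i}) v = d3"
      using sym_multilinear_diagonal[of "?J - {j} - {i}" v x] vJ' d3[OF l] card
      by simp
    have "sym_multilinear (a \<circ> Suc \<circ> Suc) (?J - {j} - {i}) v
        = poly (diagonal_poly (a \<circ> Suc \<circ> Suc) l) x"
      using sym_multilinear_diagonal[of "?J - {j} - {i}" v x] vJ' card by simp
    moreover have "d2 = poly (diagonal_poly (a \<circ> Suc \<circ> Suc) l) x + x * d3"
      unfolding d2[symmetric] d3[OF l, symmetric] l by simp
    ultimately show "sym_multilinear (a \<circ> Suc \<circ> Suc) (?J - {j} - {i}) v = d2 - x * d3" by simp
  qed
  have d1_nz: "d1 \<noteq> 0" using nz n by (simp add: d1_def)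
  have "last_coord n c = (\<lambda>v. - sym_multilinear a ?J v / sym_multilinear (a \<circ> Suc) ?J v)"
    unfolding a_def by (intro ext last_coord_sym_multilinear nk)
  then have "hessian (last_coord n c) v i j =
    2 * ((d1 - x * d2) * d1 - (d0 - x * d1) * d2) * d2 / d1^3
    - ((if i = j then 0 else d2 - x * d3) * d1 + (d1 - x * d2) * d2 - (d1 - x * d2) * d2
       - (d0 - x * d1) * (if i = j then 0 else d3)) / d1^2"
    using hessian_sym_multilinear_quotient[of ?J i j "a \<circ> Suc" v a] J V U d1_nz
      U1[OF J(1)] U1[OF J(2)] V1[OF J(1)] V1[OF J(2)] U2 V2
    by (cases "i = j") (simp_all del: atLeastAtMost_iff o_apply)
  also have "\<dots> =
    2 * d2 * (d1^2 - d0 * d2) / d1^3 - (if i = j then 0 else (d1 * d2 - d0 * d3) / d1^2)"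
    by (simp add: power2_eq_square algebra_simps)
  finally show ?thesis .
qed

text \<open>
  In terms of the normalised derivatives the entries are \<open>A\<close> and \<open>B = A - (d\<^sub>1 d\<^sub>2 - d\<^sub>0 d\<^sub>3) / d\<^sub>1\<^sup>2\<close>.
  Then \<open>A + (n - 2) B\<close> is a positive multiple of the numerator of the derivative of the ratio. The
  remaining condition \<open>d\<^sub>0 d\<^sub>3 < d\<^sub>1 d\<^sub>2\<close> holds by signs for \<open>d\<^sub>0 \<le> 0\<close>; for \<open>d\<^sub>0 > 0\<close> and \<open>n \<ge> 3\<close> it
  follows by combining the Newton-type inequalities \<open>d\<^sub>0 d\<^sub>2 < d\<^sub>1\<^sup>2\<close> and \<open>d\<^sub>1 d\<^sub>3 \<le> d\<^sub>2\<^sup>2\<close>.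
\<close>
lemma hessian_positive_definite_on_diagonal:
  fixes n :: nat and c v :: "nat \<Rightarrow> real" and x :: real
  defines "p \<equiv> diag_restriction n c"
  assumes n: "2 \<le> n" and v: "\<And>i. i \<in> {1..n-1} \<Longrightarrow> v i = x"
    and pos: "0 < poly (pderiv p) x" "0 < poly (pderiv (pderiv p)) x"
      "0 \<le> poly (pderiv (pderiv (pderiv p))) x"
    and E1: "(real n - 1) * (poly (pderiv p) x * poly (pderiv (pderiv (pderiv p))) x)
          \<le> (real n - 2) * (poly (pderiv (pderiv p)) x)^2"
    and E0: "real n * (poly p x * poly (pderiv (pderiv p)) x)
          < (real n - 1) * (poly (pderiv p) x)^2"
    and M: "0 < ratio_deriv_numerator p x"
  shows "positive_definite_on {1..n-1} (hessian (last_coord n c) v)"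
proof -
  define N where "N = real n"
  have N: "2 \<le> N" using n by (simp add: N_def)
  define d0 where "d0 = poly p x"
  define d1 where "d1 = poly (pderiv p) x / N"
  define d2 where "d2 = poly (pderiv (pderiv p)) x / (N * (N - 1))"
  define d3 where "d3 = poly (pderiv (pderiv (pderiv p))) x / (N * (N - 1) * (N - 2))"
  \<comment> \<open>For \<open>n = 2\<close> both sides vanish, which spares a separate treatment of that case.\<close>
  have p3: "poly (pderiv (pderiv (pderiv p))) x = N * (N - 1) * (N - 2) * d3"
  proof (cases "n = 2")
    case True
    have "degree (pderiv (pderiv p)) = 0"
      by (simp add: degree_pderiv p_def degree_diag_restriction True)
    then have "pderiv (pderiv (pderiv p)) = 0" by (simp add: pderiv_eq_0_iff)
    then show ?thesis by (simp add: True N_def)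
  next
    case False
    then show ?thesis using n by (simp add: d3_def N_def)
  qed
  have p1: "poly (pderiv p) x = N * d1" and p2: "poly (pderiv (pderiv p)) x = N * (N - 1) * d2"
    using N by (simp_all add: d1_def d2_def)
  have d1: "0 < d1" and d2: "0 < d2" and d3: "0 \<le> d3"
    using pos N by (simp_all add: d1_def d2_def d3_def)
  have pN: "0 < N^2 * (N - 1)" "0 < N^2 * (N - 1)^2" using N by simp_all
  have "0 < (N^2 * (N - 1)) * (d1^2 - d0 * d2)"
    using E0 unfolding p1 p2 N_def[symmetric] d0_def[symmetric]
    by (simp add: power2_eq_square algebra_simps)
  then have "0 < d1^2 - d0 * d2" using pN(1) by (rule zero_less_mult_pos)
  then have E0': "d0 * d2 < d1^2" by simp
  have "0 \<le> (N^2 * (N - 1)^2) * ((N - 2) * (d2^2 - d1 * d3))"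
    using E1 unfolding p1 p2 p3 N_def[symmetric]
    by (simp add: power2_eq_square algebra_simps)
  then have E1': "0 \<le> (N - 2) * (d2^2 - d1 * d3)"
    using pN(2) by (simp only: zero_le_mult_iff) linarith
  have cross: "d0 * d3 < d1 * d2"
  proof (cases "d0 \<le> 0 \<or> N = 2")
    case True
    moreover have "d3 = 0" if "N = 2" using that by (simp add: d3_def)
    ultimately have "d0 * d3 \<le> 0" using d3 by (auto simp: mult_nonpos_nonneg)
    then show ?thesis using d1 d2 by (smt (verit) mult_pos_pos)
  next
    case False
    then have "0 < d0" "2 < N" using N by auto
    then have "d1 * d3 \<le> d2^2" using E1' by (simp add: zero_le_mult_iff)
    then have "d0 * (d1 * d3) \<le> d0 * d2^2" using \<open>0 < d0\<close> by simp
    also have "\<dots> = d0 * d2 * d2" by (simp add: power2_eq_square)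
    also have "\<dots> < d1^2 * d2" using E0' d2 by simp
    finally have "d1 * (d0 * d3) < d1 * (d1 * d2)" by (simp add: power2_eq_square mult_ac)
    then show ?thesis using d1 by simp
  qed
  have "0 < (N^2 * (N - 1)) * (N * d1^2 * d2 + (N - 2) * d0 * d1 * d3 - 2 * (N - 1) * d0 * d2^2)"
    using M unfolding ratio_deriv_numerator_def p1 p2 p3 d0_def[symmetric]
    by (simp add: power2_eq_square algebra_simps)
  then have M': "0 < N * d1^2 * d2 + (N - 2) * d0 * d1 * d3 - 2 * (N - 1) * d0 * d2^2"
    using pN(1) by (rule zero_less_mult_pos)
  define A where "A = 2 * d2 * (d1^2 - d0 * d2) / d1^3"
  define B where "B = A - (d1 * d2 - d0 * d3) / d1^2"
  have hess: "hessian (last_coord n c) v i j = (if i = j then A else B)"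
    if "i \<in> {1..n-1}" "j \<in> {1..n-1}" for i j
    using hessian_last_coord_diagonal[of n v x c i j] n v that pos(1)
    by (simp add: A_def B_def d0_def d1_def d2_def d3_def p_def N_def)
  have "A + (real (card {1..n-1}) - 1) * B
      = (N * d1^2 * d2 + (N - 2) * d0 * d1 * d3 - 2 * (N - 1) * d0 * d2^2) / d1^3"
    using d1 n by (simp add: A_def B_def N_def of_nat_diff field_simps eval_nat_numeral)
  then have row_sum: "0 < A + (real (card {1..n-1}) - 1) * B"
    using M' d1 by simp
  have "B < A" using cross d1 by (simp add: B_def)
  then show ?thesis
    using row_sum hess by (intro positive_definite_on_equicorrelated[of _ _ A B]) auto
qed

theorem lemma1p2:
  fixes n :: nat and c :: "nat \<Rightarrow> real" and x1 :: real
  assumes "2 \<le> n"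
    and "strictly_right_noetherian (diag_restriction n c)"
    and "is_largest_real_root (pderiv (diag_restriction n c)) x1"
  shows "(\<forall>v \<in> diagonal_curve n c x1.
            positive_definite_on {1..n-1} (hessian (last_coord n c) v) \<longleftrightarrow>
            0 < deriv (log_concavity_ratio (diag_restriction n c)) (v 1))
       \<and> ((\<forall>v \<in> diagonal_curve n c x1.
            positive_definite_on {1..n-1} (hessian (last_coord n c) v)) \<longleftrightarrow>
          strict_mono_on {x1<..} (log_concavity_ratio (diag_restriction n c)))"
proof -
  let ?p = "diag_restriction n c"
  have deg: "2 \<le> degree ?p" and lc: "0 < lead_coeff ?p"
    unfolding lead_coeff_diag_restriction using assms(1) by (simp_all add: degree_diag_restriction)
  note ineqs = strictly_right_noetherian_inequalities[OF assms(2) deg lc assms(3),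
      unfolded degree_diag_restriction]
  have pd: "positive_definite_on {1..n-1} (hessian (last_coord n c) v)"
    if v: "v \<in> diagonal_curve n c x1" for v
  proof -
    have gt: "x1 < v 1" and const: "\<And>i. i \<in> {1..n-1} \<Longrightarrow> v i = v 1"
      using v unfolding diagonal_curve_def by blast+
    note ineqs_v = ineqs[OF gt]
    show ?thesis
      by (rule hessian_positive_definite_on_diagonal[OF assms(1) const ineqs_v])
  qed
  have der: "\<exists>d>0. (log_concavity_ratio ?p has_real_derivative d) (at x)" if "x1 < x" for x
    using DERIV_log_concavity_ratio[of ?p x] ineqs(1,6)[OF that]
    by (intro exI[of _ "ratio_deriv_numerator ?p x / (poly (pderiv ?p) x)^3"]) auto
  have deriv_pos: "0 < deriv (log_concavity_ratio ?p) x" if "x1 < x" for x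
    using der[OF that] DERIV_imp_deriv by metis
  have mono: "strict_mono_on {x1<..} (log_concavity_ratio ?p)"
  proof (rule strict_mono_onI)
    fix x y assume "x \<in> {x1<..}" "y \<in> {x1<..}" "x < y"
    have "\<exists>d. (log_concavity_ratio ?p has_real_derivative d) (at z) \<and> 0 < d" if "x \<le> z" for z
    proof -
      have "x1 < z" using \<open>x \<in> {x1<..}\<close> that by simp
      then show ?thesis using der by blast
    qed
    then show "log_concavity_ratio ?p x < log_concavity_ratio ?p y"
      by (rule DERIV_pos_imp_increasing[OF \<open>x < y\<close>])
  qed
  show ?thesis
  proof (intro conjI ballI)
    fix v assume v: "v \<in> diagonal_curve n c x1"
    then have "x1 < v 1" unfolding diagonal_curve_def by blast
    then show "positive_definite_on {1..n-1} (hessian (last_coord n c) v) \<longleftrightarrow>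
        0 < deriv (log_concavity_ratio ?p) (v 1)"
      using pd[OF v] deriv_pos by blast
  next
    show "(\<forall>v \<in> diagonal_curve n c x1.
        positive_definite_on {1..n-1} (hessian (last_coord n c) v)) \<longleftrightarrow>
        strict_mono_on {x1<..} (log_concavity_ratio ?p)"
      using pd mono by blast
  qed
qed

end
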